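(* Let $m_{\mathrm{DP}},m_{\mathrm{BR}},m_{\mathrm{CDP}}\ge 0$ be integers, let $\varepsilon>0$, $\alpha>0$, and $(\mu,\tau)$ with $\mu>0,\tau>0$. Consider the adaptive composition experiment over $m_{\mathrm{DP}}+m_{\mathrm{BR}}+m_{\mathrm{CDP}}$ rounds in which the analyst selects, in an order that may itself be chosen adaptively, exactly $m_{\mathrm{DP}}$ many $\varepsilon$-DP mechanisms, $m_{\mathrm{BR}}$ many $\alpha$-BR mechanisms, and $m_{\mathrm{CDP}}$ many $(\mu,\tau)$-CDP mechanisms. Then for every $\delta\in(0,1]$, this experiment is $(\varepsilon_g,\delta)$-differentially private with $$\varepsilon_g = m_{\mathrm{DP}}\,\varepsilon\left(\frac{e^{\varepsilon}-1}{e^{\varepsilon}+1}\right)+m_{\mathrm{BR}}\left(\frac{\alpha}{e^{\alpha}-1}-1-\ln\left(\frac{\alpha}{e^{\alpha}-1}\right)\right)+m_{\mathrm{CDP}}\,\mu+\sqrt{2\left(m_{\mathrm{DP}}\varepsilon^2+\frac{m_{\mathrm{BR}}}{4}\alpha^2+m_{\mathrm{CDP}}\tau^2\right)\ln(1/\delta)}.$$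
   Context: Datasets come from a data universe with a symmetric neighboring relation $x\sim x'$. A mechanism $M$ is $\varepsilon$-DP if $\Pr[M(x)\in S]\le e^{\varepsilon}\Pr[M(x')\in S]$ for all neighbors $x,x'$ and outcome sets $S$. It is $\alpha$-bounded range ($\alpha$-BR) if for all neighbors $x,x'$ and all outcomes $y_1,y_2$, $\frac{\Pr[M(x)=y_1]}{\Pr[M(x')=y_1]}\le e^{\alpha}\frac{\Pr[M(x)=y_2]}{\Pr[M(x')=y_2]}$ (masses or densities). With $L_{Y\|Z}=\ln\frac{\Pr[Y=y]}{\Pr[Z=y]}$, $y\sim Y$, it is $(\mu,\tau)$-CDP if for all neighbors $x,x'$: $\mathbb{E}[L_{M(x)\|M(x')}]\le\mu$ and for all $\lambda\in\mathbb{R}$, $\mathbb{E}[\exp(\lambda(L_{M(x)\|M(x')}-\mathbb{E}[L_{M(x)\|M(x')}]))]\le e^{\lambda^2\tau^2/2}$. Experiment $b\in\{0,1\}$ ($b$ is hidden from the analyst): at each round, as a deterministic function of the previous outcomes, the analyst selects a class (DP, BR or CDP) whose allotted number of uses has not been exhausted, a mechanism $M_i$ from that class with the given parameter(s), and a pair of neighboring datasets $x_i^{(0)},x_i^{(1)}$; the analyst then sees an outcome of $M_i(x_i^{(b)})$, generated with fresh randomness. The experiment ends when all allotted uses are exhausted. $V^{(b)}$ denotes the collection of all outcomes seen. The experiment is $(\varepsilon_g,\delta)$-differentially private if for every analyst, every $b\in\{0,1\}$ and every outcome set $S$, $\Pr[V^{(b)}\in S]\le e^{\varepsilon_g}\Pr[V^{(1-b)}\in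 S]+\delta$. *)

theory Defs
  imports "HOL-Probability.Probability"
begin

text \<open>
  Datasets are the elements of a type \<open>'d\<close> with a neighboring relation \<open>nbr\<close>. All mechanisms take
  outcomes in one arbitrary measurable space \<open>Y\<close>; mechanisms with different outcome spaces are
  covered by taking for \<open>Y\<close> the disjoint union of these spaces.
\<close>

definition mechanism :: "'y measure \<Rightarrow> ('d \<Rightarrow> 'y measure) \<Rightarrow> bool" where
  "mechanism Y M \<longleftrightarrow> (\<forall>x. M x \<in> space (prob_algebra Y))"

text \<open>
  \<open>p\<close> and \<open>q\<close> are densities of \<open>P\<close> and \<open>Q\<close> with respect to a common base measure \<open>B\<close>, which need not
  be sigma-finite. Probability masses are the case where \<open>B\<close> is a counting measure.
\<close>

definition densities ::
  "'y measure \<Rightarrow> ('y \<Rightarrow> real) \<Rightarrow> ('y \<Rightarrow> real) \<Rightarrow> 'y measure \<Rightarrow> 'y measure \<Rightarrow> bool" where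
  "densities B p q P Q \<longleftrightarrow>
     p \<in> borel_measurable B \<and> q \<in> borel_measurable B \<and>
     (\<forall>y. 0 \<le> p y) \<and> (\<forall>y. 0 \<le> q y) \<and>
     P = density B (\<lambda>y. ennreal (p y)) \<and> Q = density B (\<lambda>y. ennreal (q y))"

definition DP_mechanism ::
  "('d \<Rightarrow> 'd \<Rightarrow> bool) \<Rightarrow> 'y measure \<Rightarrow> real \<Rightarrow> ('d \<Rightarrow> 'y measure) \<Rightarrow> bool" where
  "DP_mechanism nbr Y \<epsilon> M \<longleftrightarrow> mechanism Y M \<and>
     (\<forall>x x'. nbr x x' \<longrightarrow> (\<forall>S\<in>sets Y. measure (M x) S \<le> exp \<epsilon> * measure (M x') S))"

text \<open>
  The ratios are taken in \<open>ennreal\<close>, where \<open>a / 0 = \<infinity>\<close> for \<open>a > 0\<close>. Points of density \<open>0\<close> under both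
  distributions are not outcomes, and the ratio there is the undefined \<open>0 / 0\<close>; they are excluded.
\<close>

definition BR_mechanism ::
  "('d \<Rightarrow> 'd \<Rightarrow> bool) \<Rightarrow> 'y measure \<Rightarrow> real \<Rightarrow> ('d \<Rightarrow> 'y measure) \<Rightarrow> bool" where
  "BR_mechanism nbr Y \<alpha> M \<longleftrightarrow> mechanism Y M \<and>
     (\<forall>x x'. nbr x x' \<longrightarrow>
        (\<exists>B p q. densities B p q (M x) (M x') \<and>
           (\<forall>y1\<in>space Y. \<forall>y2\<in>space Y.
              (p y1 \<noteq> 0 \<or> q y1 \<noteq> 0) \<longrightarrow> (p y2 \<noteq> 0 \<or> q y2 \<noteq> 0) \<longrightarrow>
              ennreal (p y1) / ennreal (q y1)
                \<le> ennreal (exp \<alpha>) * (ennreal (p y2) / ennreal (q y2)))))"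

definition privacy_loss :: "('y \<Rightarrow> real) \<Rightarrow> ('y \<Rightarrow> real) \<Rightarrow> 'y \<Rightarrow> real" where
  "privacy_loss p q y = ln (p y / q y)"

text \<open>
  The negative part of the privacy loss always has finite expectation. So the mean being at most
  \<open>\<mu> < \<infinity>\<close> means that the loss is almost surely finite (\<open>q > 0\<close> almost surely under \<open>M x\<close>) and
  integrable; both are stated explicitly because \<open>ln (p y / 0) = 0\<close> and the integral of a
  non-integrable function is \<open>0\<close> in HOL. For the same reason the moment generating function is a
  nonnegative integral with values in \<open>ennreal\<close>.
\<close>

definition CDP_mechanism ::
  "('d \<Rightarrow> 'd \<Rightarrow> bool) \<Rightarrow> 'y measure \<Rightarrow> real \<Rightarrow> real \<Rightarrow> ('d \<Rightarrow> 'y measure) \<Rightarrow> bool" where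
  "CDP_mechanism nbr Y \<mu> \<tau> M \<longleftrightarrow> mechanism Y M \<and>
     (\<forall>x x'. nbr x x' \<longrightarrow>
        (\<exists>B p q. densities B p q (M x) (M x') \<and>
           (AE y in M x. 0 < q y) \<and>
           integrable (M x) (privacy_loss p q) \<and>
           (\<integral>y. privacy_loss p q y \<partial>M x) \<le> \<mu> \<and>
           (\<forall>l::real.
              (\<integral>\<^sup>+y. ennreal (exp (l * (privacy_loss p q y - (\<integral>z. privacy_loss p q z \<partial>M x)))) \<partial>M x)
                \<le> ennreal (exp (l\<^sup>2 * \<tau>\<^sup>2 / 2)))))"

datatype mech_class = DP | BR | CDP

datatype ('d, 'y) query =
  Query (cls: mech_class) (mech: "'d \<Rightarrow> 'y measure") (data0: 'd) (data1: 'd)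

text \<open>
  The experiment bit is a boolean, with \<open>False\<close> for \<open>0\<close> and \<open>True\<close> for \<open>1\<close>.
\<close>

definition query_data :: "('d, 'y) query \<Rightarrow> bool \<Rightarrow> 'd" where
  "query_data Q b = (if b then data1 Q else data0 Q)"

text \<open>
  Rounds are numbered from \<open>0\<close>. \<open>A n h\<close> is the query of the analyst \<open>A\<close> in round \<open>n\<close> after the
  outcomes \<open>h 0, \<dots>, h (n - 1)\<close>, where \<open>h\<close> is an element of the product space indexed by \<open>{0..<n}\<close>.
\<close>

type_synonym ('d, 'y) analyst = "nat \<Rightarrow> (nat \<Rightarrow> 'y) \<Rightarrow> ('d, 'y) query"

definition uses :: "('d, 'y) analyst \<Rightarrow> mech_class \<Rightarrow> nat \<Rightarrow> (nat \<Rightarrow> 'y) \<Rightarrow> nat" where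
  "uses A c n h = card {i. i < n \<and> cls (A i (restrict h {0..<i})) = c}"

fun in_class ::
  "('d \<Rightarrow> 'd \<Rightarrow> bool) \<Rightarrow> 'y measure \<Rightarrow> real \<Rightarrow> real \<Rightarrow> real \<Rightarrow> real \<Rightarrow> mech_class
     \<Rightarrow> ('d \<Rightarrow> 'y measure) \<Rightarrow> bool" where
  "in_class nbr Y \<epsilon> \<alpha> \<mu> \<tau> DP M \<longleftrightarrow> DP_mechanism nbr Y \<epsilon> M"
| "in_class nbr Y \<epsilon> \<alpha> \<mu> \<tau> BR M \<longleftrightarrow> BR_mechanism nbr Y \<alpha> M"
| "in_class nbr Y \<epsilon> \<alpha> \<mu> \<tau> CDP M \<longleftrightarrow> CDP_mechanism nbr Y \<mu> \<tau> M"

text \<open>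
  The allotment \<open>m c\<close> is the number of uses of class \<open>c\<close>. Each of the first \<open>m DP + m BR + m CDP\<close>
  queries takes a class that is not yet exhausted, so after these rounds every class has been used
  exactly as often as allotted. The measurability condition makes the outcome distribution of a
  round a Markov kernel in the previous outcomes; it is automatic for countable discrete \<open>Y\<close>.
\<close>

definition rounds :: "(mech_class \<Rightarrow> nat) \<Rightarrow> nat" where
  "rounds m = m DP + m BR + m CDP"

definition valid_analyst ::
  "('d \<Rightarrow> 'd \<Rightarrow> bool) \<Rightarrow> 'y measure \<Rightarrow> real \<Rightarrow> real \<Rightarrow> real \<Rightarrow> real \<Rightarrow> (mech_class \<Rightarrow> nat)
     \<Rightarrow> ('d, 'y) analyst \<Rightarrow> bool" where
  "valid_analyst nbr Y \<epsilon> \<alpha> \<mu> \<tau> m A \<longleftrightarrow>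
     (\<forall>n < rounds m.
        (\<forall>h \<in> space (PiM {0..<n} (\<lambda>_. Y)).
           uses A (cls (A n h)) n h < m (cls (A n h)) \<and>
           in_class nbr Y \<epsilon> \<alpha> \<mu> \<tau> (cls (A n h)) (mech (A n h)) \<and>
           nbr (data0 (A n h)) (data1 (A n h))) \<and>
        (\<forall>b. (\<lambda>h. mech (A n h) (query_data (A n h) b))
                \<in> PiM {0..<n} (\<lambda>_. Y) \<rightarrow>\<^sub>M prob_algebra Y))"

primrec view :: "'y measure \<Rightarrow> ('d, 'y) analyst \<Rightarrow> bool \<Rightarrow> nat \<Rightarrow> (nat \<Rightarrow> 'y) measure" where
  "view Y A b 0 = return (PiM {0..<0} (\<lambda>_. Y)) (\<lambda>_. undefined)"
| "view Y A b (Suc n) =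
     view Y A b n \<bind> (\<lambda>h. distr (mech (A n h) (query_data (A n h) b))
                              (PiM {0..<Suc n} (\<lambda>_. Y)) (\<lambda>y. h(n := y)))"

definition experiment_DP ::
  "('d \<Rightarrow> 'd \<Rightarrow> bool) \<Rightarrow> 'y measure \<Rightarrow> real \<Rightarrow> real \<Rightarrow> real \<Rightarrow> real \<Rightarrow> (mech_class \<Rightarrow> nat)
     \<Rightarrow> real \<Rightarrow> real \<Rightarrow> bool" where
  "experiment_DP nbr Y \<epsilon> \<alpha> \<mu> \<tau> m \<epsilon>g \<delta> \<longleftrightarrow>
     (\<forall>A. valid_analyst nbr Y \<epsilon> \<alpha> \<mu> \<tau> m A \<longrightarrow>
        (\<forall>b. \<forall>S \<in> sets (PiM {0..<rounds m} (\<lambda>_. Y)).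
           measure (view Y A b (rounds m)) S
             \<le> exp \<epsilon>g * measure (view Y A (\<not> b) (rounds m)) S + \<delta>))"

end

(*
Let P and Q be the outcome distributions of one round under the two bits and let l > 0. By Young's
inequality, a moment bound E_P[exp (l * loss)] \<le> exp (l * s) yields for measurable f with values
in [0, 1], with theta = l / (1 + l),
    E_P[f^theta] \<le> exp (theta * s) * (E_Q[f])^theta.
This dual form of a bound on the Renyi divergence of order 1 + l does not mention densities. So it
composes over adaptive rounds although neither the densities nor the class chosen need depend
measurably on the history: by backward induction, for each fixed history the conditional
probabilities of the final event S satisfy it with the sum of the remaining exponents, and that sum
is the same for all outcomes of the current round. Over all rounds this gives
P(S) \<le> exp (theta * (K + l * V / 2)) * Q(S)^theta, and weighted AM-GM with
l = sqrt (2 * ln (1 / delta) / V) turns it into the claim.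

The moment bound holds with s = mean + l * variance / 2: by definition for CDP, and for DP and BR,
where the loss lies in an interval of length 2 * epsilon resp. alpha, by Hoeffding's lemma. There the
mean is bounded using E_P[exp (- loss)] = 1 and a chord of the exponential function.
*)
theory Submission
  imports Defs
begin

section \<open>Moment bounds for the privacy loss of one mechanism\<close>

text \<open>Dual, density-free form of a bound on the Renyi divergence of order 1 / (1 - \<theta>),
  which is 1 + l for \<theta> = l / (1 + l). It ranges over test functions and not only over events
  because composition applies it to the conditional probability of the final event, as a function of
  the current outcome.\<close>

definition power_dominated :: "'a measure \<Rightarrow> 'a measure \<Rightarrow> real \<Rightarrow> real \<Rightarrow> bool" where
  "power_dominated P Q \<theta> r \<longleftrightarrow>
     (\<forall>f \<in> borel_measurable Q. (\<forall>y \<in> space Q. 0 \<le> f y \<and> f y \<le> 1) \<longrightarrow>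
        (\<integral>y. f y powr \<theta> \<partial>P) \<le> exp r * (\<integral>y. f y \<partial>Q) powr \<theta>)"

lemma power_dominatedD:
  assumes "power_dominated P Q \<theta> r" "f \<in> borel_measurable Q"
    and "\<And>y. y \<in> space Q \<Longrightarrow> 0 \<le> f y" "\<And>y. y \<in> space Q \<Longrightarrow> f y \<le> 1"
  shows "(\<integral>y. f y powr \<theta> \<partial>P) \<le> exp r * (\<integral>y. f y \<partial>Q) powr \<theta>"
  using assms unfolding power_dominated_def by blast

lemma densities_measurable:
  assumes "densities B p q P Q"
  shows "p \<in> borel_measurable B" "q \<in> borel_measurable B"
    and "P = density B (\<lambda>y. ennreal (p y))" "Q = density B (\<lambda>y. ennreal (q y))"
    and "\<And>y. 0 \<le> p y" "\<And>y. 0 \<le> q y"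
  using assms by (auto simp: densities_def)

lemma ennreal_lincomb:
  assumes "0 \<le> c" "0 \<le> u" "0 \<le> d" "0 \<le> v"
  shows "ennreal c * ennreal u + ennreal d * ennreal v = ennreal (c * u + d * v)"
  using assms by (simp flip: ennreal_mult ennreal_plus)

text \<open>This is Hoelder's inequality with exponents 1 / \<theta> and 1 / (1 - \<theta>) for the
  factorization of f^\<theta> into (f * q / p)^\<theta> and exp (l * loss)^(1 - \<theta>); the
  powers of p / q cancel since l * (1 - \<theta>) = \<theta>. Both factors are normalized to
  integral at most 1, and Young's inequality is applied pointwise.\<close>

lemma power_dominated_of_moment_bound:
  fixes l s :: real
  assumes P: "prob_space P" and Q: "prob_space Q" and dens: "densities B p q P Q"
    and q_pos: "AE y in P. 0 < q y" and "0 < l"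
    and moment: "(\<integral>\<^sup>+y. ennreal (exp (l * privacy_loss p q y)) \<partial>P) \<le> ennreal (exp (l * s))"
  shows "power_dominated P Q (l / (1 + l)) (l / (1 + l) * s)"
  unfolding power_dominated_def
proof (intro ballI impI)
  fix f :: "_ \<Rightarrow> real" assume f: "f \<in> borel_measurable Q" and f01: "\<forall>y\<in>space Q. 0 \<le> f y \<and> f y \<le> 1"
  interpret P: prob_space P by fact
  interpret Q: prob_space Q by fact
  note D = densities_measurable[OF dens]
  note [measurable] = D(1,2)
  have sets [measurable_cong]: "sets P = sets B" "sets Q = sets B" by (simp_all add: D)
  have sp: "space P = space B" "space Q = space B" by (simp_all add: D)
  have fB [measurable]: "f \<in> borel_measurable B" using f sets by (simp cong: measurable_cong_sets)
  have fP [measurable]: "f \<in> borel_measurable P" using fB sets by (simp cong: measurable_cong_sets)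
  have pqP [measurable]: "p \<in> borel_measurable P" "q \<in> borel_measurable P"
    using D(1,2) sets by (simp_all cong: measurable_cong_sets)
  define \<theta> where "\<theta> = l / (1 + l)"
  have \<theta>: "0 < \<theta>" "0 < 1 - \<theta>" "l * (1 - \<theta>) = \<theta>"
    using \<open>0 < l\<close> by (auto simp: \<theta>_def field_simps)
  define A where "A = (\<integral>y. f y \<partial>Q)"
  have intf: "integrable Q f"
    by (rule Q.integrable_const_bound[where B=1]) (use f01 f in auto)
  have A0: "0 \<le> A" unfolding A_def using f01 by (intro integral_nonneg_AE) auto
  have p_pos: "AE y in P. 0 < p y"
    unfolding D(3) by (subst AE_density) auto
  have "(\<integral>y. f y powr \<theta> \<partial>P) \<le> exp (\<theta> * s) * A powr \<theta>"
  proof (cases "A = 0")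
    case True
    \<comment> \<open>There is nothing to normalize by. Instead, f vanishes almost everywhere under
      Q, and this passes to P through the base measure and \<open>q_pos\<close>.\<close>
    have "AE y in Q. f y = 0"
      using True integral_nonneg_eq_0_iff_AE[OF intf] f01 unfolding A_def by auto
    hence "AE y in B. 0 < q y \<longrightarrow> f y = 0"
      unfolding D(4) by (subst (asm) AE_density) auto
    hence "AE y in P. 0 < q y \<longrightarrow> f y = 0"
      unfolding D(3) by (subst AE_density) auto
    with q_pos have "AE y in P. f y powr \<theta> = 0" by eventually_elim auto
    hence "(\<integral>y. f y powr \<theta> \<partial>P) = (\<integral>y. 0 \<partial>P)" by (intro integral_cong_AE) auto
    thus ?thesis using True by simp
  next
    case False
    hence A: "0 < A" using A0 by simp
    define E where "E = exp (l * s)"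
    have E: "0 < E" by (simp add: E_def)
    \<comment> \<open>The product of the two normalizing factors. By \<open>Ceq\<close> it is
      exactly the claimed upper bound, so it remains to see that the normalized integrals, weighted
      by \<theta> and 1 - \<theta>, sum to at most 1.\<close>
    define C where "C = A powr \<theta> * E powr (1 - \<theta>)"
    have C: "0 < C" using A E by (simp add: C_def)
    have Ceq: "C = exp (\<theta> * s) * A powr \<theta>"
      using \<theta>(3) by (simp add: C_def E_def powr_def mult.assoc mult.left_commute)
    have pt: "AE y in P. f y powr \<theta> \<le>
        C * \<theta> / A * (f y * (q y / p y)) + C * (1 - \<theta>) / E * exp (l * privacy_loss p q y)"
      using p_pos q_pos AE_space
    proof eventually_elim
      case (elim y)
      have fy: "0 \<le> f y" using elim f01 by (simp add: sp)
      show ?case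
      proof (cases "f y = 0")
        case True
        thus ?thesis using C E \<theta> by simp
      next
        case f0: False
        define u where "u = f y * (q y / p y) / A"
        define v where "v = exp (l * privacy_loss p q y) / E"
        have uv: "0 < u" "0 < v" using f0 fy elim A E by (auto simp: u_def v_def)
        have "u powr \<theta> * v powr (1 - \<theta>) \<le> \<theta> * u + (1 - \<theta>) * v"
          using uv \<theta> by (intro Youngs_inequality_0) auto
        moreover have "C * (u powr \<theta> * v powr (1 - \<theta>)) = f y powr \<theta>"
        proof -
          have lnC: "ln C = \<theta> * ln A + (1 - \<theta>) * ln E"
            using A E by (simp add: C_def ln_mult ln_powr)
          have lnu: "ln u = ln (f y) + ln (q y) - ln (p y) - ln A"
            using f0 fy elim A by (simp add: u_def ln_mult ln_div)
          have lnv: "ln v = l * (ln (p y) - ln (q y)) - ln E"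
            using elim E by (simp add: v_def ln_div privacy_loss_def)
          have "ln C + (\<theta> * ln u + (1 - \<theta>) * ln v) = \<theta> * ln (f y) - \<theta> * (ln (p y) - ln (q y)) + (l * (1 - \<theta>)) * (ln (p y) - ln (q y))"
            unfolding lnC lnu lnv by (simp add: algebra_simps)
          hence *: "ln C + (\<theta> * ln u + (1 - \<theta>) * ln v) = \<theta> * ln (f y)" using \<theta>(3) by simp
          have "C * (u powr \<theta> * v powr (1 - \<theta>)) = exp (ln C + (\<theta> * ln u + (1 - \<theta>) * ln v))"
            using uv C by (simp add: powr_def exp_add)
          thus ?thesis unfolding * using f0 by (simp add: powr_def)
        qed
        ultimately have "f y powr \<theta> \<le> C * (\<theta> * u + (1 - \<theta>) * v)"
          using C by (metis mult_left_mono less_imp_le)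
        thus ?thesis by (simp add: u_def v_def algebra_simps)
      qed
    qed
    have pt': "AE y in P. ennreal (f y powr \<theta>) \<le> ennreal (C * \<theta> / A) * ennreal (f y * (q y / p y))
        + ennreal (C * (1 - \<theta>) / E) * ennreal (exp (l * privacy_loss p q y))"
      using pt AE_space
    proof eventually_elim
      case (elim y)
      have "0 \<le> f y * (q y / p y)" using elim f01 sp D(5)[of y] D(6)[of y] by auto
      hence "ennreal (C * \<theta> / A) * ennreal (f y * (q y / p y))
          + ennreal (C * (1 - \<theta>) / E) * ennreal (exp (l * privacy_loss p q y))
        = ennreal (C * \<theta> / A * (f y * (q y / p y)) + C * (1 - \<theta>) / E * exp (l * privacy_loss p q y))"
        using C A E \<theta> by (intro ennreal_lincomb) auto
      thus ?case using ennreal_leI[OF elim(1)] by simp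
    qed
    \<comment> \<open>Only an inequality: Q may charge the set where \<open>p\<close> vanishes, and
      there the left integrand is 0.\<close>
    have I1: "(\<integral>\<^sup>+y. ennreal (f y * (q y / p y)) \<partial>P) \<le> ennreal A"
    proof -
      have "(\<integral>\<^sup>+y. ennreal (f y * (q y / p y)) \<partial>P) = (\<integral>\<^sup>+y. ennreal (p y) * ennreal (f y * (q y / p y)) \<partial>B)"
        unfolding D(3) by (rule nn_integral_density) auto
      also have "\<dots> \<le> (\<integral>\<^sup>+y. ennreal (q y) * ennreal (f y) \<partial>B)"
      proof (rule nn_integral_mono)
        fix y assume "y \<in> space B"
        hence "0 \<le> f y" using f01 sp by auto
        thus "ennreal (p y) * ennreal (f y * (q y / p y)) \<le> ennreal (q y) * ennreal (f y)"
          using D(5)[of y] D(6)[of y] by (cases "p y = 0") (auto simp flip: ennreal_mult)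
      qed
      also have "\<dots> = (\<integral>\<^sup>+y. ennreal (f y) \<partial>Q)"
        unfolding D(4) by (rule nn_integral_density[symmetric]) auto
      also have "\<dots> = ennreal A"
        unfolding A_def using f01 intf by (intro nn_integral_eq_integral) auto
      finally show ?thesis .
    qed
    have "ennreal (\<integral>y. f y powr \<theta> \<partial>P) = (\<integral>\<^sup>+y. ennreal (f y powr \<theta>) \<partial>P)"
      by (rule nn_integral_eq_integral[symmetric], rule P.integrable_const_bound[where B=1])
        (use f01 \<theta> sp in \<open>auto simp: powr_le_one_le powr_le1\<close>)
    also have "\<dots> \<le> (\<integral>\<^sup>+y. ennreal (C * \<theta> / A) * ennreal (f y * (q y / p y))
        + ennreal (C * (1 - \<theta>) / E) * ennreal (exp (l * privacy_loss p q y)) \<partial>P)"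
      by (rule nn_integral_mono_AE[OF pt'])
    also have "\<dots> = ennreal (C * \<theta> / A) * (\<integral>\<^sup>+y. ennreal (f y * (q y / p y)) \<partial>P)
        + ennreal (C * (1 - \<theta>) / E) * (\<integral>\<^sup>+y. ennreal (exp (l * privacy_loss p q y)) \<partial>P)"
      unfolding privacy_loss_def by (simp add: nn_integral_add nn_integral_cmult)
    also have "\<dots> \<le> ennreal (C * \<theta> / A) * ennreal A + ennreal (C * (1 - \<theta>) / E) * ennreal E"
      using I1 moment unfolding E_def by (intro add_mono mult_left_mono) auto
    also have "\<dots> = ennreal (C * \<theta> / A * A + C * (1 - \<theta>) / E * E)"
      using A E C \<theta> by (intro ennreal_lincomb) auto
    also have "C * \<theta> / A * A + C * (1 - \<theta>) / E * E = C"
      using A E by (simp add: field_simps)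
    finally show ?thesis using C Ceq by simp
  qed
  thus "(\<integral>y. f y powr (l / (1 + l)) \<partial>P) \<le> exp (l / (1 + l) * s) * (\<integral>y. f y \<partial>Q) powr (l / (1 + l))"
    by (simp add: \<theta>_def A_def)
qed

section \<open>Losses in a bounded interval: mean and moment generating function\<close>

text \<open>By convexity, exp lies below its chord over [0, w]. Used with s = b - loss, this bounds
  the loss by an affine function of exp (- loss).\<close>

lemma exp_chord_le:
  fixes s w :: real
  assumes "0 \<le> s" "s \<le> w" "0 < w"
  shows "w / (exp w - 1) * (exp s - 1) \<le> s"
proof -
  have "exp ((1 - s / w) *\<^sub>R 0 + (s / w) *\<^sub>R w) \<le> (1 - s / w) * exp 0 + (s / w) * exp w"
    using assms by (intro convex_onD[OF exp_convex]) auto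
  hence "exp s - 1 \<le> s / w * (exp w - 1)" using assms by (simp add: algebra_simps)
  hence "w / (exp w - 1) * (exp s - 1) \<le> w / (exp w - 1) * (s / w * (exp w - 1))"
    using assms by (intro mult_left_mono) auto
  also have "\<dots> = s" using assms by simp
  finally show ?thesis .
qed

text \<open>Change of measure: p * exp (- loss) = q almost everywhere, so the integral is the total
  mass of Q. \<open>p_pos\<close> ensures that no mass of Q is missed where p = 0;
  \<open>q_pos\<close> rules out points with p > 0 and q = 0, where the loss would be the default
  value 0.\<close>

lemma nn_integral_exp_neg_privacy_loss:
  assumes Q: "prob_space Q" and dens: "densities B p q P Q"
    and q_pos: "AE y in P. 0 < q y" and p_pos: "AE y in Q. 0 < p y"
  shows "(\<integral>\<^sup>+y. ennreal (exp (- privacy_loss p q y)) \<partial>P) = 1"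
proof -
  interpret Q: prob_space Q by fact
  note D = densities_measurable[OF dens]
  note [measurable] = D(1,2)
  have "AE y in B. 0 < p y \<longrightarrow> 0 < q y"
    using q_pos unfolding D(3) by (subst (asm) AE_density) auto
  moreover have "AE y in B. 0 < q y \<longrightarrow> 0 < p y"
    using p_pos unfolding D(4) by (subst (asm) AE_density) auto
  ultimately have ae: "AE y in B. ennreal (p y) * ennreal (exp (- privacy_loss p q y)) = ennreal (q y) * 1"
  proof eventually_elim
    case (elim y)
    show ?case
    proof (cases "p y = 0")
      case True
      thus ?thesis using elim D(6)[of y] by auto
    next
      case False
      hence pq: "0 < p y" "0 < q y" using elim D(5)[of y] by auto
      have "exp (- privacy_loss p q y) = q y / p y"
        using pq by (simp add: privacy_loss_def exp_minus)
      thus ?thesis using pq by (simp flip: ennreal_mult)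
    qed
  qed
  have "(\<integral>\<^sup>+y. ennreal (exp (- privacy_loss p q y)) \<partial>P)
      = (\<integral>\<^sup>+y. ennreal (p y) * ennreal (exp (- privacy_loss p q y)) \<partial>B)"
    unfolding D(3) privacy_loss_def by (rule nn_integral_density) auto
  also have "\<dots> = (\<integral>\<^sup>+y. ennreal (q y) * 1 \<partial>B)"
    by (rule nn_integral_cong_AE[OF ae])
  also have "\<dots> = (\<integral>\<^sup>+y. 1 \<partial>Q)"
    unfolding D(4) by (rule nn_integral_density[symmetric]) auto
  also have "\<dots> = 1" using Q.emeasure_space_1 by simp
  finally show ?thesis .
qed

text \<open>Here b is the upper end and w the length of the interval containing the loss. Averaging
  the chord inequality with E_P[exp (- loss)] = 1 bounds the mean by the left side of
  \<open>k\<close>; Hoeffding's lemma contributes the variance proxy w^2 / 4.\<close>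

lemma moment_bound_of_bounded_loss:
  fixes b w k l :: real
  assumes P: "prob_space P" and Q: "prob_space Q" and dens: "densities B p q P Q"
    and q_pos: "AE y in P. 0 < q y" and p_pos: "AE y in Q. 0 < p y"
    and bounded: "AE y in P. privacy_loss p q y \<in> {b - w..b}" and "0 < w" and "0 < l"
    and k: "b - w / (exp w - 1) * (exp b - 1) \<le> k"
  shows "(\<integral>\<^sup>+y. ennreal (exp (l * privacy_loss p q y)) \<partial>P)
           \<le> ennreal (exp (l * (k + l * (w\<^sup>2 / 4) / 2)))"
proof -
  interpret P: prob_space P by fact
  note D = densities_measurable[OF dens]
  have sets [measurable_cong]: "sets P = sets B" by (simp add: D)
  have pqP [measurable]: "p \<in> borel_measurable P" "q \<in> borel_measurable P"
    using D(1,2) sets by (simp_all cong: measurable_cong_sets)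
  define L where "L = privacy_loss p q"
  have L [measurable]: "L \<in> borel_measurable P" unfolding L_def privacy_loss_def by measurable
  interpret L: interval_bounded_random_variable P L "b - w" b
  proof unfold_locales
    show "AE y in P. L y \<in> {b - w..b}" using bounded unfolding L_def .
  qed (rule L)
  have intL: "integrable P (\<lambda>y. exp (- L y))"
  proof (rule P.integrable_const_bound[where B="exp (w - b)"])
    show "AE y in P. norm (exp (- L y)) \<le> exp (w - b)"
      using L.AE_in_interval by eventually_elim auto
  qed auto
  have "ennreal (\<integral>y. exp (- L y) \<partial>P) = 1"
    using nn_integral_eq_integral[OF intL] nn_integral_exp_neg_privacy_loss[OF Q dens q_pos p_pos]
    by (simp add: L_def)
  hence E1: "(\<integral>y. exp (- L y) \<partial>P) = 1" by simp
  have "(\<integral>y. L y \<partial>P) \<le> (\<integral>y. b - w / (exp w - 1) * (exp b * exp (- L y) - 1) \<partial>P)"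
  proof (rule integral_mono_AE)
    show "AE y in P. L y \<le> b - w / (exp w - 1) * (exp b * exp (- L y) - 1)"
      using L.AE_in_interval
    proof eventually_elim
      case (elim y)
      have "w / (exp w - 1) * (exp (b - L y) - 1) \<le> b - L y"
        using elim \<open>0 < w\<close> by (intro exp_chord_le) auto
      thus ?case by (simp add: exp_diff exp_minus divide_inverse)
    qed
  qed (use intL L.integrable in auto)
  also have "\<dots> = b - w / (exp w - 1) * (exp b * 1 - 1)"
    using intL E1 by (simp add: P.prob_space)
  finally have mean: "(\<integral>y. L y \<partial>P) \<le> k" using k by simp
  have "(\<integral>\<^sup>+y. ennreal (exp (l * L y)) \<partial>P)
      = (\<integral>\<^sup>+y. ennreal (exp (l * P.expectation L)) * ennreal (exp (l * (L y - P.expectation L))) \<partial>P)"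
    by (simp flip: ennreal_mult exp_add add: algebra_simps)
  also have "\<dots> = ennreal (exp (l * P.expectation L)) * (\<integral>\<^sup>+y. ennreal (exp (l * (L y - P.expectation L))) \<partial>P)"
    by (rule nn_integral_cmult) auto
  \<comment> \<open>Replacing the mean by its bound k uses l > 0. The denominator 8 of Hoeffding's
    lemma is split as 4 * 2.\<close>
  also have "\<dots> \<le> ennreal (exp (l * k)) * ennreal (exp (l\<^sup>2 * (b - (b - w))\<^sup>2 / 8))"
    using mean \<open>0 < l\<close> by (intro mult_mono L.Hoeffdings_lemma_nn_integral ennreal_leI) auto
  also have "\<dots> = ennreal (exp (l * (k + l * (w\<^sup>2 / 4) / 2)))"
    by (simp flip: ennreal_mult exp_add add: algebra_simps power2_eq_square)
  finally show ?thesis by (simp add: L_def)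
qed

section \<open>The three mechanism classes\<close>

text \<open>It suffices to test the set where h < g: there the integral of g - h is both nonnegative
  and at most 0, so the set is null.\<close>

lemma AE_le_of_set_integral_le:
  fixes g h :: "'a \<Rightarrow> real"
  assumes g: "integrable M g" and h: "integrable M h"
    and le: "\<And>S. S \<in> sets M \<Longrightarrow> (\<integral>y. indicator S y * g y \<partial>M) \<le> (\<integral>y. indicator S y * h y \<partial>M)"
  shows "AE y in M. g y \<le> h y"
proof -
  define S where "S = {y \<in> space M. h y < g y}"
  have [measurable]: "g \<in> borel_measurable M" "h \<in> borel_measurable M" using g h by auto
  have S [measurable]: "S \<in> sets M" unfolding S_def by measurable
  have int: "integrable M (\<lambda>y. indicator S y * g y)" "integrable M (\<lambda>y. indicator S y * h y)"
    using g h integrable_mult_indicator[OF S, of g] integrable_mult_indicator[OF S, of h] by auto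
  have nonneg: "0 \<le> indicator S y * g y - indicator S y * h y" for y
    by (auto simp: indicator_def S_def)
  have "(\<integral>y. indicator S y * g y - indicator S y * h y \<partial>M) \<le> 0"
    using le[OF S] int by simp
  moreover have "0 \<le> (\<integral>y. indicator S y * g y - indicator S y * h y \<partial>M)"
    using nonneg by simp
  ultimately have "AE y in M. indicator S y * g y - indicator S y * h y = 0"
    using integral_nonneg_eq_0_iff_AE[of M "\<lambda>y. indicator S y * g y - indicator S y * h y"] int nonneg
    by auto
  thus ?thesis
    using AE_space by eventually_elim (auto simp: S_def indicator_def split: if_splits)
qed

text \<open>Differential privacy speaks of events only, so densities have to be constructed. The
  bound on P makes it absolutely continuous, Q itself serves as base measure, and p is the
  Radon-Nikodym derivative; the two bounds on events then become almost everywhere bounds on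
  p.\<close>

lemma exists_density_of_ratio_bounds:
  fixes \<epsilon> :: real
  assumes P: "prob_space P" and Q: "prob_space Q" and sets: "sets P = sets Q"
    and PQ: "\<And>S. S \<in> sets Q \<Longrightarrow> measure P S \<le> exp \<epsilon> * measure Q S"
    and QP: "\<And>S. S \<in> sets Q \<Longrightarrow> measure Q S \<le> exp \<epsilon> * measure P S"
  obtains p where "densities Q p (\<lambda>_. 1) P Q" "AE y in Q. exp (- \<epsilon>) \<le> p y \<and> p y \<le> exp \<epsilon>"
proof -
  interpret P: prob_space P by fact
  interpret Q: prob_space Q by fact
  have ac: "absolutely_continuous Q P"
    unfolding absolutely_continuous_def
  proof
    fix S assume "S \<in> null_sets Q"
    hence "S \<in> sets Q" "measure Q S = 0" by (auto simp: null_sets_def measure_def)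
    thus "S \<in> null_sets P"
      using PQ[of S] sets by (auto simp: null_sets_def P.emeasure_eq_measure measure_le_0_iff)
  qed
  obtain p where p [measurable]: "p \<in> borel_measurable Q"
    and RN: "AE y in Q. RN_deriv Q P y = ennreal (p y)" and p0: "\<And>y. 0 \<le> p y"
    using Q.real_RN_deriv[OF P.finite_measure_axioms ac sets] by metis
  have P_eq: "P = density Q (\<lambda>y. ennreal (p y))"
  proof -
    have "P = density Q (RN_deriv Q P)" using Q.density_RN_deriv[OF ac sets] by simp
    also have "\<dots> = density Q (\<lambda>y. ennreal (p y))" using RN by (intro density_cong) auto
    finally show ?thesis .
  qed
  have int_p: "integrable Q p"
  proof -
    have "integrable P (\<lambda>_. 1 :: real)" by simp
    thus ?thesis unfolding P_eq using p0 by (subst (asm) integrable_density) auto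
  qed
  have meas_P: "measure P S = (\<integral>y. indicator S y * p y \<partial>Q)" if S: "S \<in> sets Q" for S
  proof -
    have "measure P S = (\<integral>y. indicator S y \<partial>P)" using S sets by simp
    also have "\<dots> = (\<integral>y. p y *\<^sub>R indicator S y \<partial>Q)"
      unfolding P_eq using p0 S by (intro integral_density) auto
    finally show ?thesis by (simp add: mult.commute)
  qed
  have meas_Q: "c * measure Q S = (\<integral>y. indicator S y * c \<partial>Q)" if "S \<in> sets Q" for S c
    using that by (simp add: mult.commute)
  have "AE y in Q. p y \<le> exp \<epsilon>"
  proof (rule AE_le_of_set_integral_le[OF int_p])
    fix S assume S: "S \<in> sets Q"
    show "(\<integral>y. indicator S y * p y \<partial>Q) \<le> (\<integral>y. indicator S y * exp \<epsilon> \<partial>Q)"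
      using PQ[OF S] unfolding meas_P[OF S] meas_Q[OF S] .
  qed simp
  moreover have "AE y in Q. exp (- \<epsilon>) \<le> p y"
  proof (rule AE_le_of_set_integral_le[OF _ int_p])
    fix S assume S: "S \<in> sets Q"
    have "exp (- \<epsilon>) * measure Q S \<le> exp (- \<epsilon>) * (exp \<epsilon> * measure P S)"
      using QP[OF S] by (intro mult_left_mono) auto
    also have "\<dots> = measure P S" by (simp add: exp_minus)
    finally show "(\<integral>y. indicator S y * exp (- \<epsilon>) \<partial>Q) \<le> (\<integral>y. indicator S y * p y \<partial>Q)"
      unfolding meas_P[OF S] meas_Q[OF S] .
  qed simp
  ultimately have "AE y in Q. exp (- \<epsilon>) \<le> p y \<and> p y \<le> exp \<epsilon>" by auto
  moreover have "densities Q p (\<lambda>_. 1) P Q"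
    using p p0 P_eq by (simp add: densities_def density_1)
  ultimately show ?thesis using that by blast
qed

lemma mechanism_prob:
  assumes "mechanism Y M"
  shows "prob_space (M x)" "sets (M x) = sets Y" "space (M x) = space Y"
proof -
  show "prob_space (M x)" and s: "sets (M x) = sets Y"
    using assms by (auto simp: mechanism_def space_prob_algebra)
  from s show "space (M x) = space Y" by (rule sets_eq_imp_space_eq)
qed

text \<open>Symmetry of the neighboring relation gives both ratio bounds, so the loss lies in
  [-\<epsilon>, \<epsilon>]: the case b = \<epsilon>, w = 2 * \<epsilon> of the interval bound, with
  variance proxy (2 * \<epsilon>)^2 / 4 = \<epsilon>^2.\<close>

lemma DP_power_dominated:
  assumes M: "DP_mechanism nbr Y \<epsilon> M" and "symp nbr" and nbr: "nbr x x'"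
    and "0 < \<epsilon>" and "0 < l"
  shows "power_dominated (M x) (M x') (l / (1 + l))
    (l / (1 + l) * (\<epsilon> * ((exp \<epsilon> - 1) / (exp \<epsilon> + 1)) + l * \<epsilon>\<^sup>2 / 2))"
proof -
  have mech: "mechanism Y M" using M by (simp add: DP_mechanism_def)
  note prob = mechanism_prob[OF mech]
  have nbr': "nbr x' x" using \<open>symp nbr\<close> nbr by (auto dest: sympD)
  obtain p where dens: "densities (M x') p (\<lambda>_. 1) (M x) (M x')"
    and p: "AE y in M x'. exp (- \<epsilon>) \<le> p y \<and> p y \<le> exp \<epsilon>"
    using M nbr nbr' prob
    by (rule_tac exists_density_of_ratio_bounds[of "M x" "M x'" \<epsilon>]) (auto simp: DP_mechanism_def)
  note D = densities_measurable[OF dens]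
  have p_pos: "AE y in M x'. 0 < p y"
    using p by eventually_elim (use exp_gt_zero less_le_trans in blast)
  have "AE y in M x. exp (- \<epsilon>) \<le> p y \<and> p y \<le> exp \<epsilon>"
    using p D(1) by (subst D(3), subst AE_density) auto
  hence bounded: "AE y in M x. privacy_loss p (\<lambda>_. 1) y \<in> {\<epsilon> - 2 * \<epsilon>..\<epsilon>}"
  proof eventually_elim
    case (elim y)
    have "0 < p y" using elim exp_gt_zero less_le_trans by blast
    hence "ln (exp (- \<epsilon>)) \<le> ln (p y)" "ln (p y) \<le> ln (exp \<epsilon>)"
      using elim by (simp_all only: ln_le_cancel_iff exp_gt_zero)
    thus ?case by (simp add: privacy_loss_def)
  qed
  \<comment> \<open>The mean bound from the chord, simplified by exp (2 * \<epsilon>) - 1 = (exp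
    \<epsilon> - 1) * (exp \<epsilon> + 1). It is \<epsilon> * tanh (\<epsilon> / 2).\<close>
  have "\<epsilon> - 2 * \<epsilon> / (exp (2 * \<epsilon>) - 1) * (exp \<epsilon> - 1) = \<epsilon> * ((exp \<epsilon> - 1) / (exp \<epsilon> + 1))"
  proof -
    define e where "e = exp \<epsilon>"
    have e: "1 < e" "exp (2 * \<epsilon>) = e * e" using \<open>0 < \<epsilon>\<close> by (auto simp: e_def simp flip: exp_add)
    have "e * e - 1 = (e - 1) * (e + 1)" by (simp add: algebra_simps)
    moreover have "2 * \<epsilon> / ((e - 1) * (e + 1)) * (e - 1) = 2 * \<epsilon> / (e + 1)" using e by simp
    moreover have "\<epsilon> - 2 * \<epsilon> / (e + 1) = \<epsilon> * ((e - 1) / (e + 1))"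
      using e by (simp add: field_simps)
    ultimately show ?thesis unfolding e(2) e_def[symmetric] by metis
  qed
  hence "(\<integral>\<^sup>+y. ennreal (exp (l * privacy_loss p (\<lambda>_. 1) y)) \<partial>M x)
      \<le> ennreal (exp (l * (\<epsilon> * ((exp \<epsilon> - 1) / (exp \<epsilon> + 1)) + l * ((2 * \<epsilon>)\<^sup>2 / 4) / 2)))"
    using prob bounded p_pos \<open>0 < \<epsilon>\<close> \<open>0 < l\<close>
    by (intro moment_bound_of_bounded_loss[OF _ _ dens]) auto
  hence "power_dominated (M x) (M x') (l / (1 + l))
      (l / (1 + l) * (\<epsilon> * ((exp \<epsilon> - 1) / (exp \<epsilon> + 1)) + l * ((2 * \<epsilon>)\<^sup>2 / 4) / 2))"
    using prob \<open>0 < l\<close> by (intro power_dominated_of_moment_bound[OF _ _ dens]) auto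
  thus ?thesis by (simp add: power2_eq_square)
qed

text \<open>Bounded range confines the loss to an interval of length \<alpha> but leaves its upper
  end b unknown. With t = \<alpha> / (exp \<alpha> - 1), the chord bound b - t * (exp b - 1) on the
  mean is maximal at b = - ln t, with value t - 1 - ln t.\<close>

lemma BR_power_dominated:
  assumes M: "BR_mechanism nbr Y \<alpha> M" and nbr: "nbr x x'" and "0 < \<alpha>" and "0 < l"
  shows "power_dominated (M x) (M x') (l / (1 + l))
    (l / (1 + l) * (\<alpha> / (exp \<alpha> - 1) - 1 - ln (\<alpha> / (exp \<alpha> - 1)) + l * (\<alpha>\<^sup>2 / 4) / 2))"
proof -
  have mech: "mechanism Y M" using M by (simp add: BR_mechanism_def)
  note prob = mechanism_prob[OF mech]
  interpret P: prob_space "M x" by (rule prob)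
  interpret Q: prob_space "M x'" by (rule prob)
  obtain B p q where dens: "densities B p q (M x) (M x')"
    and ratio: "\<And>y1 y2. y1 \<in> space Y \<Longrightarrow> y2 \<in> space Y \<Longrightarrow> p y1 \<noteq> 0 \<or> q y1 \<noteq> 0 \<Longrightarrow> p y2 \<noteq> 0 \<or> q y2 \<noteq> 0
      \<Longrightarrow> ennreal (p y1) / ennreal (q y1) \<le> ennreal (exp \<alpha>) * (ennreal (p y2) / ennreal (q y2))"
    using M nbr unfolding BR_mechanism_def by metis
  note D = densities_measurable[OF dens]
  have AE_p: "AE y in M x. p y \<noteq> 0 \<and> y \<in> space Y"
  proof -
    have "AE y in M x. p y \<noteq> 0" using D(1) by (subst D(3), subst AE_density) auto
    thus ?thesis using AE_space[of "M x"] prob(3) by auto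
  qed
  have AE_q: "AE y in M x'. q y \<noteq> 0 \<and> y \<in> space Y"
  proof -
    have "AE y in M x'. q y \<noteq> 0" using D(2) by (subst D(4), subst AE_density) auto
    thus ?thesis using AE_space[of "M x'"] prob(3) by auto
  qed
  obtain yp where yp: "p yp \<noteq> 0" "yp \<in> space Y"
  proof (rule ccontr)
    assume "\<not> thesis"
    hence none: "\<And>y. \<not> (p y \<noteq> 0 \<and> y \<in> space Y)" using that by blast
    have "AE y in M x. False" using AE_p by eventually_elim (use none in blast)
    thus False by simp
  qed
  obtain yq where yq: "q yq \<noteq> 0" "yq \<in> space Y"
  proof (rule ccontr)
    assume "\<not> thesis"
    hence none: "\<And>y. \<not> (q y \<noteq> 0 \<and> y \<in> space Y)" using that by blast
    have "AE y in M x'. False" using AE_q by eventually_elim (use none in blast)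
    thus False by simp
  qed
  define Z where "Z = {y \<in> space Y. p y \<noteq> 0 \<or> q y \<noteq> 0}"
  \<comment> \<open>Where either density is positive, both are. A zero of p has ratio 0, which would
    force the ratio at \<open>yp\<close> to be 0; a zero of q has ratio \<infinity>, which the
    finite ratio at \<open>yq\<close> cannot bound.\<close>
  have pq_pos: "0 < p y" "0 < q y" if "y \<in> Z" for y
  proof -
    have y: "y \<in> space Y" "p y \<noteq> 0 \<or> q y \<noteq> 0" using that by (auto simp: Z_def)
    show "0 < p y"
    proof (rule ccontr)
      assume "\<not> 0 < p y"
      hence "p y = 0" using D(5)[of y] by simp
      hence "ennreal (p yp) / ennreal (q yp) \<le> 0"
        using ratio[of yp y] yp y by simp
      thus False using yp D(5)[of yp] by (auto simp: ennreal_divide_eq_0_iff ennreal_eq_0_iff)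
    qed
    show "0 < q y"
    proof (rule ccontr)
      assume "\<not> 0 < q y"
      hence "q y = 0" "0 < p y" using D(6)[of y] y(2) D(5)[of y] by auto
      hence "\<top> \<le> ennreal (exp \<alpha>) * (ennreal (p yq) / ennreal (q yq))"
        using ratio[of y yq] yq y by (simp add: ennreal_divide_zero)
      moreover have "ennreal (p yq) / ennreal (q yq) < \<top>"
        using yq D(5)[of yq] D(6)[of yq] by (simp add: divide_ennreal)
      ultimately show False by (simp add: top_unique ennreal_mult_eq_top_iff)
    qed
  qed
  define L where "L = privacy_loss p q"
  have L_le: "L y1 \<le> \<alpha> + L y2" if "y1 \<in> Z" "y2 \<in> Z" for y1 y2
  proof -
    note pos = pq_pos[OF that(1)] pq_pos[OF that(2)]
    have "ennreal (p y1) / ennreal (q y1) \<le> ennreal (exp \<alpha>) * (ennreal (p y2) / ennreal (q y2))"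
      using that by (intro ratio) (auto simp: Z_def)
    also have "ennreal (p y2) / ennreal (q y2) = ennreal (p y2 / q y2)"
      using pos by (intro divide_ennreal) auto
    also have "ennreal (p y1) / ennreal (q y1) = ennreal (p y1 / q y1)"
      using pos by (intro divide_ennreal) auto
    also have "ennreal (exp \<alpha>) * ennreal (p y2 / q y2) = ennreal (exp \<alpha> * (p y2 / q y2))"
      using pos by (intro ennreal_mult[symmetric]) auto
    finally have "p y1 / q y1 \<le> exp \<alpha> * (p y2 / q y2)" using pos by (subst (asm) ennreal_le_iff) auto
    hence "ln (p y1 / q y1) \<le> ln (exp \<alpha> * (p y2 / q y2))"
      using pos by (subst ln_le_cancel_iff) auto
    also have "\<dots> = \<alpha> + ln (p y2 / q y2)" using pos by (subst ln_mult) auto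
    finally show ?thesis by (simp add: L_def privacy_loss_def)
  qed
  \<comment> \<open>The interval is anchored at the supremum of the loss over the common support. By
    \<open>L_le\<close> the supremum exceeds no value of the loss there by more than
    \<alpha>.\<close>
  define b where "b = (SUP y\<in>Z. L y)"
  have Z0: "yp \<in> Z" using yp by (auto simp: Z_def)
  have bdd: "bdd_above (L ` Z)" using L_le[OF _ Z0] by (intro bdd_aboveI2) auto
  have range: "L y \<in> {b - \<alpha>..b}" if "y \<in> Z" for y
  proof -
    have "L y \<le> b" unfolding b_def using bdd that by (rule cSUP_upper2) simp
    moreover have "b \<le> \<alpha> + L y" unfolding b_def using Z0 L_le[OF _ that] by (intro cSUP_least) auto
    ultimately show ?thesis by simp
  qed
  have AE_Z: "AE y in M x. y \<in> Z" "AE y in M x'. y \<in> Z"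
    using AE_p AE_q by (auto simp: Z_def)
  define t where "t = \<alpha> / (exp \<alpha> - 1)"
  have "0 < t" using \<open>0 < \<alpha>\<close> by (simp add: t_def)
  \<comment> \<open>The maximization over b, in the form ln z \<le> z - 1 at z = t * exp b.\<close>
  hence "ln t + b \<le> t * exp b - 1"
    using ln_le_minus_one[of "t * exp b"] by (simp add: ln_mult)
  hence k: "b - t * (exp b - 1) \<le> t - 1 - ln t" by (simp add: algebra_simps)
  have "(\<integral>\<^sup>+y. ennreal (exp (l * privacy_loss p q y)) \<partial>M x)
      \<le> ennreal (exp (l * (t - 1 - ln t + l * (\<alpha>\<^sup>2 / 4) / 2)))"
  proof (rule moment_bound_of_bounded_loss[OF prob(1) prob(1) dens])
    show "AE y in M x. privacy_loss p q y \<in> {b - \<alpha>..b}"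
      using AE_Z(1) by eventually_elim (use range in \<open>simp add: L_def\<close>)
    show "AE y in M x. 0 < q y" using AE_Z(1) by eventually_elim (rule pq_pos)
    show "AE y in M x'. 0 < p y" using AE_Z(2) by eventually_elim (rule pq_pos)
  qed (use k \<open>0 < \<alpha>\<close> \<open>0 < l\<close> in \<open>simp_all add: t_def\<close>)
  moreover have "AE y in M x. 0 < q y" using AE_Z(1) by eventually_elim (rule pq_pos)
  ultimately show ?thesis
    using prob \<open>0 < l\<close> unfolding t_def
    by (intro power_dominated_of_moment_bound[OF _ _ dens]) auto
qed

text \<open>The centred moment bound of the definition is multiplied by exp (l * mean), and the mean
  is replaced by \<mu>, using l > 0.\<close>

lemma CDP_power_dominated:
  assumes M: "CDP_mechanism nbr Y \<mu> \<tau> M" and nbr: "nbr x x'" and "0 < l"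
  shows "power_dominated (M x) (M x') (l / (1 + l)) (l / (1 + l) * (\<mu> + l * \<tau>\<^sup>2 / 2))"
proof -
  have mech: "mechanism Y M" using M by (simp add: CDP_mechanism_def)
  note prob = mechanism_prob[OF mech]
  obtain B p q where dens: "densities B p q (M x) (M x')" and q_pos: "AE y in M x. 0 < q y"
    and mean: "(\<integral>y. privacy_loss p q y \<partial>M x) \<le> \<mu>" and int: "integrable (M x) (privacy_loss p q)"
    and mgf: "(\<integral>\<^sup>+y. ennreal (exp (l * (privacy_loss p q y - (\<integral>z. privacy_loss p q z \<partial>M x)))) \<partial>M x)
                \<le> ennreal (exp (l\<^sup>2 * \<tau>\<^sup>2 / 2))"
    using M nbr unfolding CDP_mechanism_def by metis
  have [measurable]: "privacy_loss p q \<in> borel_measurable (M x)" using int by auto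
  define e where "e = (\<integral>y. privacy_loss p q y \<partial>M x)"
  have "(\<integral>\<^sup>+y. ennreal (exp (l * privacy_loss p q y)) \<partial>M x)
      = (\<integral>\<^sup>+y. ennreal (exp (l * e)) * ennreal (exp (l * (privacy_loss p q y - e))) \<partial>M x)"
    by (simp flip: ennreal_mult exp_add add: algebra_simps)
  also have "\<dots> = ennreal (exp (l * e)) * (\<integral>\<^sup>+y. ennreal (exp (l * (privacy_loss p q y - e))) \<partial>M x)"
    by (rule nn_integral_cmult) auto
  also have "\<dots> \<le> ennreal (exp (l * \<mu>)) * ennreal (exp (l\<^sup>2 * \<tau>\<^sup>2 / 2))"
    using mean mgf \<open>0 < l\<close> by (intro mult_mono ennreal_leI) (auto simp: e_def)
  also have "\<dots> = ennreal (exp (l * (\<mu> + l * \<tau>\<^sup>2 / 2)))"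
    by (simp flip: ennreal_mult exp_add add: algebra_simps power2_eq_square)
  finally show ?thesis
    using prob q_pos \<open>0 < l\<close> by (intro power_dominated_of_moment_bound[OF _ _ dens]) auto
qed

section \<open>Adaptive composition\<close>

context
  fixes Y :: "'y measure" and A :: "('d, 'y) analyst" and N :: nat
  assumes kernel: "\<And>n b. n < N \<Longrightarrow>
    (\<lambda>h. mech (A n h) (query_data (A n h) b)) \<in> PiM {0..<n} (\<lambda>_. Y) \<rightarrow>\<^sub>M prob_algebra Y"
begin

section \<open>The view as a process continued from a fixed history\<close>

definition step :: "bool \<Rightarrow> nat \<Rightarrow> (nat \<Rightarrow> 'y) \<Rightarrow> (nat \<Rightarrow> 'y) measure" where
  "step b n h = distr (mech (A n h) (query_data (A n h) b)) (PiM {0..<Suc n} (\<lambda>_. Y)) (\<lambda>y. h(n := y))"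

text \<open>\<open>view\<close> appends rounds at the end, whereas the backward induction fixes a
  history and splits off the first of the rounds still to come. The same process is therefore
  rebuilt from the front.\<close>

primrec continuation :: "bool \<Rightarrow> nat \<Rightarrow> nat \<Rightarrow> (nat \<Rightarrow> 'y) \<Rightarrow> (nat \<Rightarrow> 'y) measure" where
  "continuation b 0 n h = return (PiM {0..<n} (\<lambda>_. Y)) h"
| "continuation b (Suc k) n h = step b n h \<bind> continuation b k (Suc n)"

lemma measurable_append:
  "(\<lambda>(h, y). h(n := y)) \<in> PiM {0..<n} (\<lambda>_. Y) \<Otimes>\<^sub>M Y \<rightarrow>\<^sub>M PiM {0..<Suc n} (\<lambda>_. Y)"
  using measurable_add_dim[of n "{0..<n}" "\<lambda>_. Y"] by (simp add: atLeast0_lessThan_Suc)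

lemma measurable_step:
  assumes "n < N"
  shows "step b n \<in> PiM {0..<n} (\<lambda>_. Y) \<rightarrow>\<^sub>M prob_algebra (PiM {0..<Suc n} (\<lambda>_. Y))"
  unfolding step_def
  by (rule measurable_distr_prob_space2[OF kernel[OF assms] measurable_append])

lemma measurable_continuation:
  assumes "n + k \<le> N"
  shows "continuation b k n \<in> PiM {0..<n} (\<lambda>_. Y) \<rightarrow>\<^sub>M prob_algebra (PiM {0..<n + k} (\<lambda>_. Y))"
  using assms
proof (induction k arbitrary: n)
  case 0
  have "continuation b 0 n = return (PiM {0..<n} (\<lambda>_. Y))" by (rule ext) simp
  thus ?case using measurable_return_prob_space by simp
next
  case (Suc k)
  have "continuation b (Suc k) n = (\<lambda>h. step b n h \<bind> continuation b k (Suc n))" by (rule ext) simp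
  moreover have "continuation b k (Suc n) \<in> PiM {0..<Suc n} (\<lambda>_. Y) \<rightarrow>\<^sub>M prob_algebra (PiM {0..<n + Suc k} (\<lambda>_. Y))"
    using Suc.IH[of "Suc n"] Suc.prems by simp
  ultimately show ?case
    using measurable_step[of n b] Suc.prems by (auto intro: measurable_bind_prob_space)
qed

lemma view_Suc: "view Y A b (Suc n) = view Y A b n \<bind> step b n"
proof -
  have "step b n = (\<lambda>h. distr (mech (A n h) (query_data (A n h) b)) (PiM {0..<Suc n} (\<lambda>_. Y)) (\<lambda>y. h(n := y)))"
    by (rule ext) (rule step_def)
  thus ?thesis by simp
qed

lemma view_in_prob_algebra:
  assumes "n \<le> N"
  shows "view Y A b n \<in> space (prob_algebra (PiM {0..<n} (\<lambda>_. Y)))"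
  using assms
proof (induction n)
  case 0
  show ?case
    by (auto simp: space_prob_algebra space_PiM intro!: prob_space_return)
next
  case (Suc n)
  hence V: "view Y A b n \<in> space (prob_algebra (PiM {0..<n} (\<lambda>_. Y)))" and "n < N" by auto
  note step = measurable_step[OF \<open>n < N\<close>, of b]
  show ?case
    unfolding view_Suc using prob_space_bind'[OF V step] sets_bind'[OF V step]
    by (simp add: space_prob_algebra)
qed

text \<open>Associativity of bind moves one round after another from the continuation to the view.
  The case n = 0 identifies the two descriptions of the experiment.\<close>

lemma view_bind_continuation:
  assumes "n + k \<le> N"
  shows "view Y A b n \<bind> continuation b k n = view Y A b (n + k)"
  using assms
proof (induction k arbitrary: n)
  case 0
  have "continuation b 0 n = return (PiM {0..<n} (\<lambda>_. Y))" by (rule ext) simp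
  moreover have "sets (view Y A b n) = sets (PiM {0..<n} (\<lambda>_. Y))"
    using view_in_prob_algebra[of n b] 0 by (simp add: space_prob_algebra)
  ultimately show ?case by (simp add: bind_return'')
next
  case (Suc k)
  have eq: "continuation b (Suc k) n = (\<lambda>h. step b n h \<bind> continuation b k (Suc n))" by (rule ext) simp
  have sets: "sets (view Y A b n) = sets (PiM {0..<n} (\<lambda>_. Y))"
    using view_in_prob_algebra[of n b] Suc.prems by (simp add: space_prob_algebra)
  have "(view Y A b n \<bind> step b n) \<bind> continuation b k (Suc n) = view Y A b n \<bind> continuation b (Suc k) n"
    unfolding eq
  proof (rule bind_assoc)
    show "step b n \<in> view Y A b n \<rightarrow>\<^sub>M subprob_algebra (PiM {0..<Suc n} (\<lambda>_. Y))"
      using measurable_prob_algebraD[OF measurable_step[of n b]] Suc.prems sets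
      by (simp cong: measurable_cong_sets)
    show "continuation b k (Suc n) \<in> PiM {0..<Suc n} (\<lambda>_. Y) \<rightarrow>\<^sub>M subprob_algebra (PiM {0..<Suc n + k} (\<lambda>_. Y))"
      using measurable_prob_algebraD[OF measurable_continuation[of "Suc n" k b]] Suc.prems by simp
  qed
  thus ?case
    using Suc.IH[of "Suc n"] Suc.prems by (simp add: view_Suc del: view.simps continuation.simps)
qed

lemma view_eq_continuation:
  assumes "n \<le> N"
  shows "view Y A b n = continuation b n 0 (\<lambda>_. undefined)"
proof -
  have "view Y A b 0 \<bind> continuation b n 0 = continuation b n 0 (\<lambda>_. undefined)"
    unfolding view.simps
    by (rule bind_return[OF measurable_prob_algebraD[OF measurable_continuation[of 0 n b]]])
      (use assms in \<open>auto simp: space_PiM\<close>)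
  thus ?thesis using view_bind_continuation[of 0 n b] assms by simp
qed

text \<open>The tower property for the current round. The function in the second claim is the
  conditional probability of S given the current outcome, the test function to which
  \<open>power_dominated\<close> will be applied.\<close>

lemma measure_continuation_Suc:
  assumes "n + Suc k \<le> N" and h: "h \<in> space (PiM {0..<n} (\<lambda>_. Y))"
    and S: "S \<in> sets (PiM {0..<n + Suc k} (\<lambda>_. Y))"
  shows "measure (continuation b (Suc k) n h) S
    = (\<integral>y. measure (continuation b k (Suc n) (h(n := y))) S \<partial>mech (A n h) (query_data (A n h) b))"
    and "(\<lambda>y. measure (continuation b k (Suc n) (h(n := y))) S) \<in> borel_measurable Y"
proof -
  let ?M = "mech (A n h) (query_data (A n h) b)"
  have M: "?M \<in> space (prob_algebra Y)"
    using kernel[of n b] assms(1) h by (intro measurable_space[of "\<lambda>h. mech (A n h) (query_data (A n h) b)"]) auto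
  have setsM: "sets ?M = sets Y" using M by (simp add: space_prob_algebra)
  have app: "(\<lambda>y. h(n := y)) \<in> Y \<rightarrow>\<^sub>M PiM {0..<Suc n} (\<lambda>_. Y)"
    using measurable_compose[OF measurable_Pair1'[OF h] measurable_append] by simp
  have step: "step b n h \<in> space (prob_algebra (PiM {0..<Suc n} (\<lambda>_. Y)))"
    using measurable_step[of n b] assms(1) h by (intro measurable_space[of "step b n"]) auto
  interpret st: prob_space "step b n h" using step by (simp add: space_prob_algebra)
  have sets_st: "sets (step b n h) = sets (PiM {0..<Suc n} (\<lambda>_. Y))"
    using step by (simp add: space_prob_algebra)
  have cont: "continuation b k (Suc n) \<in> PiM {0..<Suc n} (\<lambda>_. Y) \<rightarrow>\<^sub>M subprob_algebra (PiM {0..<n + Suc k} (\<lambda>_. Y))"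
    using measurable_prob_algebraD[OF measurable_continuation[of "Suc n" k b]] assms(1) by simp
  have meas: "(\<lambda>g. measure (continuation b k (Suc n) g) S) \<in> borel_measurable (PiM {0..<Suc n} (\<lambda>_. Y))"
    using measurable_compose[OF cont measurable_measure_subprob_algebra[OF S]] .
  show "(\<lambda>y. measure (continuation b k (Suc n) (h(n := y))) S) \<in> borel_measurable Y"
    using measurable_compose[OF app meas] .
  have "measure (continuation b (Suc k) n h) S = (\<integral>g. measure (continuation b k (Suc n) g) S \<partial>step b n h)"
    unfolding continuation.simps
    by (rule st.measure_bind[OF _ S]) (use cont sets_st in \<open>simp cong: measurable_cong_sets\<close>)
  also have "\<dots> = (\<integral>y. measure (continuation b k (Suc n) (h(n := y))) S \<partial>?M)"
    unfolding step_def
    by (rule integral_distr) (use app meas setsM in \<open>simp_all cong: measurable_cong_sets\<close>)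
  finally show "measure (continuation b (Suc k) n h) S = (\<integral>y. measure (continuation b k (Suc n) (h(n := y))) S \<partial>?M)" .
qed

section \<open>Accounting of the remaining uses, and the backward induction\<close>

text \<open>\<open>uses\<close> replays the analyst on prefixes of the history. A new outcome
  changes no prefix of length at most n, and the prefix of length n is h itself because h is
  extensional.\<close>

lemma uses_Suc_append:
  assumes h: "h \<in> space (PiM {0..<n} (\<lambda>_. Y))"
  shows "uses A c (Suc n) (h(n := y)) = uses A c n h + (if cls (A n h) = c then 1 else 0)"
proof -
  have res: "restrict (h(n := y)) {0..<i} = restrict h {0..<i}" if "i \<le> n" for i
    using that by (auto simp: restrict_def)
  have hn: "restrict h {0..<n} = h"
    using h by (auto simp: space_PiM intro: PiE_restrict)
  have "{i. i < Suc n \<and> cls (A i (restrict (h(n := y)) {0..<i})) = c}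
      = {i. i < n \<and> cls (A i (restrict h {0..<i})) = c} \<union> (if cls (A n h) = c then {n} else {})"
    using res res[of n] hn by (auto simp: less_Suc_eq)
  moreover have "card ({i. i < n \<and> cls (A i (restrict h {0..<i})) = c} \<union> (if cls (A n h) = c then {n} else {}))
      = card {i. i < n \<and> cls (A i (restrict h {0..<i})) = c} + (if cls (A n h) = c then 1 else 0)"
    by (subst card_Un_disjoint) auto
  ultimately show ?thesis unfolding uses_def by simp
qed

text \<open>
  The truncated subtraction keeps every summand nonnegative; the analyst's allotment condition
  ensures that it is a proper subtraction whenever a round is charged.
\<close>

definition remaining :: "(mech_class \<Rightarrow> nat) \<Rightarrow> (mech_class \<Rightarrow> real) \<Rightarrow> nat \<Rightarrow> (nat \<Rightarrow> 'y) \<Rightarrow> real" where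
  "remaining m r n h = (\<Sum>c\<in>{DP, BR, CDP}. real (m c - uses A c n h) * r c)"

text \<open>The point is that y is arbitrary: the cost left after the current round is the same for
  all of its outcomes, even though the later choice of classes depends on them.\<close>

lemma remaining_append:
  assumes h: "h \<in> space (PiM {0..<n} (\<lambda>_. Y))"
    and "uses A (cls (A n h)) n h < m (cls (A n h))"
  shows "remaining m r n h = r (cls (A n h)) + remaining m r (Suc n) (h(n := y))"
  using assms(2) unfolding remaining_def uses_Suc_append[OF h]
  by (cases "cls (A n h)") (simp_all add: of_nat_diff algebra_simps)

text \<open>Induction on the number k of rounds left, for all histories at once. The induction
  hypothesis bounds the conditional probability of S after each outcome; domination for the current
  round then turns the integral under bit \<open>b\<close> into one under \<open>b'\<close>. The
  history stays fixed throughout, so the exponents need not be measurable in it.\<close>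

lemma measure_continuation_le:
  assumes \<theta>: "0 < \<theta>" "\<theta> \<le> 1" and r: "\<And>c. 0 \<le> r c"
    and allot: "\<And>n h. n < N \<Longrightarrow> h \<in> space (PiM {0..<n} (\<lambda>_. Y)) \<Longrightarrow>
      uses A (cls (A n h)) n h < m (cls (A n h))"
    and dom: "\<And>n h. n < N \<Longrightarrow> h \<in> space (PiM {0..<n} (\<lambda>_. Y)) \<Longrightarrow>
      power_dominated (mech (A n h) (query_data (A n h) b)) (mech (A n h) (query_data (A n h) b'))
        \<theta> (r (cls (A n h)))"
    and "n + k = N" and h: "h \<in> space (PiM {0..<n} (\<lambda>_. Y))" and S: "S \<in> sets (PiM {0..<N} (\<lambda>_. Y))"
  shows "measure (continuation b k n h) S
    \<le> exp (remaining m r n h) * measure (continuation b' k n h) S powr \<theta>"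
  using \<open>n + k = N\<close> h
proof (induction k arbitrary: n h)
  case 0
  \<comment> \<open>The probability of S is now 0 or 1 and hence fixed by
    \<open>powr \<theta>\<close>, so a nonnegative exponent suffices.\<close>
  have "0 \<le> remaining m r n h" unfolding remaining_def using r by (intro sum_nonneg) auto
  moreover have "measure (return (PiM {0..<n} (\<lambda>_. Y)) h) S = indicator S h"
    using S 0 by (simp add: measure_return)
  ultimately show ?case by (auto simp: indicator_def)
next
  case (Suc k)
  let ?M = "\<lambda>b. mech (A n h) (query_data (A n h) b)"
  let ?C = "\<lambda>b y. measure (continuation b k (Suc n) (h(n := y))) S"
  \<comment> \<open>The cost after this round, written without reference to its outcome so that it
    is a constant factor of the integral.\<close>
  let ?R = "remaining m r n h - r (cls (A n h))"
  have nk: "n + Suc k \<le> N" "n < N" using Suc.prems by auto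
  have S': "S \<in> sets (PiM {0..<n + Suc k} (\<lambda>_. Y))" using S Suc.prems by simp
  note C = measure_continuation_Suc[OF nk(1) Suc.prems(2) S']
  have M: "?M b \<in> space (prob_algebra Y)" for b
    using kernel[of n b] nk Suc.prems(2)
    by (intro measurable_space[of "\<lambda>h. mech (A n h) (query_data (A n h) b)"]) auto
  have setsM [measurable_cong]: "sets (?M b) = sets Y" for b using M[of b] by (simp add: space_prob_algebra)
  have spM: "space (?M b) = space Y" for b by (rule sets_eq_imp_space_eq[OF setsM])
  interpret M: prob_space "?M b" using M[of b] by (simp add: space_prob_algebra)
  have app: "h(n := y) \<in> space (PiM {0..<Suc n} (\<lambda>_. Y))" if "y \<in> space Y" for y
    using measurable_space[OF measurable_append, of "(h, y)" n] that Suc.prems(2)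
    by (simp add: space_pair_measure)
  have C_le1: "?C b y \<le> 1" if "y \<in> space Y" for b y
  proof -
    have "continuation b k (Suc n) (h(n := y)) \<in> space (prob_algebra (PiM {0..<Suc n + k} (\<lambda>_. Y)))"
      using measurable_continuation[of "Suc n" k b] app[OF that] nk(1)
      by (intro measurable_space[of "continuation b k (Suc n)"]) auto
    then interpret c: prob_space "continuation b k (Suc n) (h(n := y))" by (simp add: space_prob_algebra)
    show ?thesis by simp
  qed
  have [measurable]: "?C b \<in> borel_measurable Y" for b by (rule C(2))
  have IH: "?C b y \<le> exp ?R * ?C b' y powr \<theta>" if "y \<in> space Y" for y
  proof -
    have "Suc n + k = N" using Suc.prems by simp
    moreover have "remaining m r (Suc n) (h(n := y)) = ?R"
      using remaining_append[where m=m and r=r and y=y, OF Suc.prems(2) allot[OF nk(2) Suc.prems(2)]]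
      by linarith
    ultimately show ?thesis using Suc.IH[OF _ app[OF that]] by metis
  qed
  have powr_le1: "?C b' y powr \<theta> \<le> 1" if "y \<in> space Y" for y
    using C_le1[OF that] \<theta> by (intro powr_le1) auto
  have "measure (continuation b (Suc k) n h) S = (\<integral>y. ?C b y \<partial>?M b)" by (rule C(1))
  also have "\<dots> \<le> (\<integral>y. exp ?R * ?C b' y powr \<theta> \<partial>?M b)"
  proof (rule integral_mono)
    show "integrable (?M b) (?C b)"
      by (rule M.integrable_const_bound[where B=1]) (use C_le1 spM in auto)
    have "integrable (?M b) (\<lambda>y. ?C b' y powr \<theta>)"
      by (rule M.integrable_const_bound[where B=1]) (use powr_le1 spM in auto)
    thus "integrable (?M b) (\<lambda>y. exp ?R * ?C b' y powr \<theta>)" by simp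
  qed (use IH spM in auto)
  also have "\<dots> = exp ?R * (\<integral>y. ?C b' y powr \<theta> \<partial>?M b)" by simp
  also have "\<dots> \<le> exp ?R * (exp (r (cls (A n h))) * (\<integral>y. ?C b' y \<partial>?M b') powr \<theta>)"
    using dom[OF nk(2) Suc.prems(2)] C_le1 spM
    by (intro mult_left_mono power_dominatedD) auto
  also have "\<dots> = exp (remaining m r n h) * measure (continuation b' (Suc k) n h) S powr \<theta>"
    unfolding C(1)[of b'] mult.assoc[symmetric] exp_add[symmetric] by simp
  finally show ?case .
qed

lemma measure_view_le:
  assumes "0 < \<theta>" "\<theta> \<le> 1" and "\<And>c. 0 \<le> r c"
    and "\<And>n h. n < N \<Longrightarrow> h \<in> space (PiM {0..<n} (\<lambda>_. Y)) \<Longrightarrow>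
      uses A (cls (A n h)) n h < m (cls (A n h))"
    and "\<And>n h. n < N \<Longrightarrow> h \<in> space (PiM {0..<n} (\<lambda>_. Y)) \<Longrightarrow>
      power_dominated (mech (A n h) (query_data (A n h) b)) (mech (A n h) (query_data (A n h) b'))
        \<theta> (r (cls (A n h)))"
    and "S \<in> sets (PiM {0..<N} (\<lambda>_. Y))"
  shows "measure (view Y A b N) S
    \<le> exp (real (m DP) * r DP + real (m BR) * r BR + real (m CDP) * r CDP)
       * measure (view Y A b' N) S powr \<theta>"
proof -
  have "measure (continuation b N 0 (\<lambda>_. undefined)) S
      \<le> exp (remaining m r 0 (\<lambda>_. undefined)) * measure (continuation b' N 0 (\<lambda>_. undefined)) S powr \<theta>"
    by (rule measure_continuation_le) (use assms in \<open>auto simp: space_PiM\<close>)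
  moreover have "remaining m r 0 (\<lambda>_. undefined) = real (m DP) * r DP + real (m BR) * r BR + real (m CDP) * r CDP"
    by (simp add: remaining_def uses_def)
  ultimately show ?thesis by (simp add: view_eq_continuation)
qed

end

section \<open>Conversion to approximate differential privacy and the final bound\<close>

text \<open>The right side of \<open>x\<close> is a weighted geometric mean of exp (K + l * V) * t
  and \<delta>, with weights \<theta> and 1 - \<theta>. The given l makes the exponents match; it is
  the minimizer of K + l * V / 2 + ln (1 / \<delta>) / l, whose minimum is K + l * V.\<close>

lemma approximate_bound_of_power_bound:
  fixes K V x t \<delta> :: real
  assumes "0 < V" and \<delta>: "0 < \<delta>" "\<delta> < 1" and "0 \<le> t"
    and l: "l = sqrt (2 * ln (1 / \<delta>) / V)"
    and x: "x \<le> exp (l / (1 + l) * (K + l * V / 2)) * t powr (l / (1 + l))"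
  shows "x \<le> exp (K + sqrt (2 * V * ln (1 / \<delta>))) * t + \<delta>"
proof (cases "t = 0")
  case True
  thus ?thesis using x \<delta> by simp
next
  case False
  hence t: "0 < t" using \<open>0 \<le> t\<close> by simp
  define d where "d = ln (1 / \<delta>)"
  have d: "0 < d" "ln \<delta> = - d" using \<delta> by (simp_all add: d_def ln_div)
  have l0: "0 < l" and l2: "l\<^sup>2 = 2 * d / V"
    using d \<open>0 < V\<close> by (simp_all add: l d_def[symmetric])
  have "sqrt (2 * V * d) = l * V"
  proof (rule real_sqrt_unique)
    show "(l * V)\<^sup>2 = 2 * V * d"
      using \<open>0 < V\<close> by (simp add: power_mult_distrib l2) (simp add: power2_eq_square)
  qed (use l0 \<open>0 < V\<close> in auto)
  hence root: "sqrt (2 * V * ln (1 / \<delta>)) = l * V" by (simp add: d_def)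
  define X where "X = exp (K + l * V)"
  define \<theta> where "\<theta> = l / (1 + l)"
  have \<theta>: "0 < \<theta>" "0 < 1 - \<theta>" "(1 - \<theta>) * l = \<theta>" using l0 by (simp_all add: \<theta>_def field_simps)
  have dl: "d = l * (l * V / 2)" using l2 \<open>0 < V\<close> by (simp add: power2_eq_square field_simps)
  \<comment> \<open>This is where the choice of l enters: d = l^2 * V / 2, and (1 - \<theta>) * l =
    \<theta> turns (1 - \<theta>) * d into half of \<theta> * l * V.\<close>
  have exponent: "\<theta> * (K + l * V) - (1 - \<theta>) * d = \<theta> * (K + l * V / 2)"
  proof -
    have "(1 - \<theta>) * d = ((1 - \<theta>) * l) * (l * V / 2)" by (simp add: dl)
    thus ?thesis unfolding \<theta>(3) by (simp add: algebra_simps)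
  qed
  have "exp (\<theta> * (K + l * V / 2)) * t powr \<theta> = (X * t) powr \<theta> * \<delta> powr (1 - \<theta>)"
  proof -
    have "(X * t) powr \<theta> = exp (\<theta> * (K + l * V) + \<theta> * ln t)"
      using t by (simp add: powr_def X_def ln_mult distrib_left)
    moreover have "\<delta> powr (1 - \<theta>) = exp (- ((1 - \<theta>) * d))"
      using \<delta> d(2) by (simp add: powr_def)
    moreover have "t powr \<theta> = exp (\<theta> * ln t)" using t by (simp add: powr_def)
    ultimately show ?thesis unfolding exponent[symmetric] by (simp flip: exp_add)
  qed
  also have "\<dots> \<le> \<theta> * (X * t) + (1 - \<theta>) * \<delta>"
    using \<theta> t \<delta> by (intro Youngs_inequality_0) (auto simp: X_def)
  also have "\<dots> \<le> 1 * (X * t) + 1 * \<delta>"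
    using \<theta> t \<delta> by (intro add_mono mult_right_mono) (auto simp: X_def)
  finally show ?thesis using x unfolding root by (simp add: X_def \<theta>_def)
qed

theorem mainTheorem2:
  fixes nbr :: "'d \<Rightarrow> 'd \<Rightarrow> bool" and Y :: "'y measure"
    and m :: "mech_class \<Rightarrow> nat" and \<epsilon> \<alpha> \<mu> \<tau> \<delta> :: real
  assumes "symp nbr"
    and "\<epsilon> > 0" and "\<alpha> > 0" and "\<mu> > 0" and "\<tau> > 0"
    and "\<delta> > 0" and "\<delta> \<le> 1"
  shows "experiment_DP nbr Y \<epsilon> \<alpha> \<mu> \<tau> m
    (real (m DP) * \<epsilon> * ((exp \<epsilon> - 1) / (exp \<epsilon> + 1))
      + real (m BR) * (\<alpha> / (exp \<alpha> - 1) - 1 - ln (\<alpha> / (exp \<alpha> - 1)))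
      + real (m CDP) * \<mu>
      + sqrt (2 * (real (m DP) * \<epsilon>\<^sup>2 + real (m BR) / 4 * \<alpha>\<^sup>2 + real (m CDP) * \<tau>\<^sup>2) * ln (1 / \<delta>)))
    \<delta>"
  unfolding experiment_DP_def
proof (intro allI impI ballI)
  fix A :: "('d, 'y) analyst" and b S
  assume valid: "valid_analyst nbr Y \<epsilon> \<alpha> \<mu> \<tau> m A"
    and S: "S \<in> sets (PiM {0..<rounds m} (\<lambda>_. Y))"
  let ?N = "rounds m"
  define K where "K = real (m DP) * \<epsilon> * ((exp \<epsilon> - 1) / (exp \<epsilon> + 1))
      + real (m BR) * (\<alpha> / (exp \<alpha> - 1) - 1 - ln (\<alpha> / (exp \<alpha> - 1))) + real (m CDP) * \<mu>"
  define V where "V = real (m DP) * \<epsilon>\<^sup>2 + real (m BR) / 4 * \<alpha>\<^sup>2 + real (m CDP) * \<tau>\<^sup>2"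
  have kernel: "(\<lambda>h. mech (A n h) (query_data (A n h) b)) \<in> PiM {0..<n} (\<lambda>_. Y) \<rightarrow>\<^sub>M prob_algebra Y"
    if "n < ?N" for n b
    using valid that unfolding valid_analyst_def by blast
  have query: "uses A (cls (A n h)) n h < m (cls (A n h))"
      "in_class nbr Y \<epsilon> \<alpha> \<mu> \<tau> (cls (A n h)) (mech (A n h))" "nbr (data0 (A n h)) (data1 (A n h))"
    if "n < ?N" "h \<in> space (PiM {0..<n} (\<lambda>_. Y))" for n h
    using valid that unfolding valid_analyst_def by blast+
  have prob: "prob_space (view Y A b ?N)" for b
    using view_in_prob_algebra[where b=b, OF kernel order_refl] by (simp add: space_prob_algebra)
  have "measure (view Y A b ?N) S \<le> exp (K + sqrt (2 * V * ln (1 / \<delta>))) * measure (view Y A (\<not> b) ?N) S + \<delta>"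
  \<comment> \<open>The cases in which l is not positive: \<delta> = 1 gives ln (1 / \<delta>) = 0,
    and without rounds V = 0. The first is trivial because probabilities are at most 1, the second
    because both views are the same point mass.\<close>
  proof (cases "\<delta> = 1 \<or> ?N = 0")
    case True
    thus ?thesis
    proof
      assume "\<delta> = 1"
      moreover have "measure (view Y A b ?N) S \<le> 1" using prob by (rule prob_space.prob_le_1)
      ultimately show ?thesis by (simp add: add_increasing)
    next
      assume N: "?N = 0"
      hence "K = 0" "V = 0" by (simp_all add: rounds_def K_def V_def)
      thus ?thesis using N \<open>\<delta> > 0\<close> by simp
    qed
  next
    case False
    hence \<delta>: "\<delta> < 1" and "m DP > 0 \<or> m BR > 0 \<or> m CDP > 0"
      using \<open>\<delta> \<le> 1\<close> by (auto simp: rounds_def)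
    hence "0 < real (m DP) * \<epsilon>\<^sup>2 \<or> 0 < real (m BR) / 4 * \<alpha>\<^sup>2 \<or> 0 < real (m CDP) * \<tau>\<^sup>2"
      using assms by auto
    moreover have "0 \<le> real (m DP) * \<epsilon>\<^sup>2" "0 \<le> real (m BR) / 4 * \<alpha>\<^sup>2" "0 \<le> real (m CDP) * \<tau>\<^sup>2"
      by simp_all
    ultimately have V: "0 < V" unfolding V_def by linarith
    define l where "l = sqrt (2 * ln (1 / \<delta>) / V)"
    have "0 < ln (1 / \<delta>)" using \<delta> \<open>\<delta> > 0\<close> by simp
    hence l: "0 < l" using V by (simp add: l_def)
    define \<theta> where "\<theta> = l / (1 + l)"
    have \<theta>: "0 < \<theta>" "\<theta> \<le> 1" using l by (simp_all add: \<theta>_def)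
    \<comment> \<open>The cost of one use of each class, \<theta> * (mean + l * variance / 2).
      Weighted with the allotments, these add up to \<theta> * (K + l * V / 2).\<close>
    define r where "r = case_mech_class
      (\<theta> * (\<epsilon> * ((exp \<epsilon> - 1) / (exp \<epsilon> + 1)) + l * \<epsilon>\<^sup>2 / 2))
      (\<theta> * (\<alpha> / (exp \<alpha> - 1) - 1 - ln (\<alpha> / (exp \<alpha> - 1)) + l * (\<alpha>\<^sup>2 / 4) / 2))
      (\<theta> * (\<mu> + l * \<tau>\<^sup>2 / 2))"
    have "0 \<le> \<alpha> / (exp \<alpha> - 1) - 1 - ln (\<alpha> / (exp \<alpha> - 1))"
      using ln_le_minus_one[of "\<alpha> / (exp \<alpha> - 1)"] \<open>\<alpha> > 0\<close> by simp
    hence r0: "0 \<le> r c" for c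
      using assms \<theta> l unfolding r_def by (cases c) (auto intro!: mult_nonneg_nonneg add_nonneg_nonneg)
    have class_dom: "power_dominated (M x) (M x') \<theta> (r c)"
      if "in_class nbr Y \<epsilon> \<alpha> \<mu> \<tau> c M" "nbr x x'" for c M x x'
      using that DP_power_dominated[of nbr Y \<epsilon> M x x' l] BR_power_dominated[of nbr Y \<alpha> M x x' l]
        CDP_power_dominated[of nbr Y \<mu> \<tau> M x x' l] assms l
      unfolding r_def \<theta>_def by (cases c) auto
    \<comment> \<open>For \<open>b = True\<close> the two datasets exchange their roles, so symmetry
      of \<open>nbr\<close> is applied.\<close>
    have dom: "power_dominated (mech (A n h) (query_data (A n h) b)) (mech (A n h) (query_data (A n h) (\<not> b)))
        \<theta> (r (cls (A n h)))" if "n < ?N" "h \<in> space (PiM {0..<n} (\<lambda>_. Y))" for n h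
      using query[OF that] \<open>symp nbr\<close> by (intro class_dom) (auto simp: query_data_def dest: sympD)
    have "measure (view Y A b ?N) S
        \<le> exp (real (m DP) * r DP + real (m BR) * r BR + real (m CDP) * r CDP)
           * measure (view Y A (\<not> b) ?N) S powr \<theta>"
      by (rule measure_view_le[OF kernel \<theta> r0 query(1) dom S])
    also have "real (m DP) * r DP + real (m BR) * r BR + real (m CDP) * r CDP = \<theta> * (K + l * V / 2)"
      by (simp add: r_def K_def V_def algebra_simps)
    finally have "measure (view Y A b ?N) S
        \<le> exp (\<theta> * (K + l * V / 2)) * measure (view Y A (\<not> b) ?N) S powr \<theta>" .
    thus ?thesis
      using V \<open>\<delta> > 0\<close> \<delta> unfolding \<theta>_def by (intro approximate_bound_of_power_bound[OF _ _ _ _ l_def]) auto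
  qed
  thus "measure (view Y A b ?N) S
      \<le> exp (real (m DP) * \<epsilon> * ((exp \<epsilon> - 1) / (exp \<epsilon> + 1))
        + real (m BR) * (\<alpha> / (exp \<alpha> - 1) - 1 - ln (\<alpha> / (exp \<alpha> - 1)))
        + real (m CDP) * \<mu>
        + sqrt (2 * (real (m DP) * \<epsilon>\<^sup>2 + real (m BR) / 4 * \<alpha>\<^sup>2 + real (m CDP) * \<tau>\<^sup>2) * ln (1 / \<delta>)))
        * measure (view Y A (\<not> b) ?N) S + \<delta>"
    unfolding K_def V_def .
qed

end
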